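(* Let $m,k$ be nonnegative integers. Then for every integer $n\ge 0$ with $n+k\ge m$, the coefficient of $x^n$ in the formal power series expansion of $$\frac{(1-x)^m}{(1-2x)^{k+1}}$$ equals $\binom{m,\,n+k-m}{k}$.
   Context: For nonnegative integers $m,n,k$, let $X$ be a set that is the disjoint union of blocks $X_1,\dots,X_n,Y$ with $|X_i|=2$ for $i=1,\dots,n$ and $|Y|=m$. The number $\binom{m,n}{k}$ is defined as the number of $(n+k)$-element subsets of $X$ that intersect each block $X_i$, $i=1,\dots,n$ (such subsets are called $(n+k)$-insets of $X$). *)

theory Defs
  imports "HOL-Library.Disjoint_Sets" "HOL-Computational_Algebra.Formal_Power_Series"
begin

definition block_system ::
    "nat \<Rightarrow> nat \<Rightarrow> 'a set \<Rightarrow> (nat \<Rightarrow> 'a set) \<Rightarrow> 'a set \<Rightarrow> bool" where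
  "block_system m n X B Y \<longleftrightarrow>
     X = (\<Union>i\<in>{1..n}. B i) \<union> Y \<and>
     disjoint_family_on B {1..n} \<and> (\<forall>i\<in>{1..n}. B i \<inter> Y = {}) \<and>
     (\<forall>i\<in>{1..n}. card (B i) = 2) \<and> finite Y \<and> card Y = m"

definition insets :: "nat \<Rightarrow> nat \<Rightarrow> 'a set \<Rightarrow> (nat \<Rightarrow> 'a set) \<Rightarrow> 'a set set" where
  "insets n k X B = {S. S \<subseteq> X \<and> card S = n + k \<and> (\<forall>i\<in>{1..n}. S \<inter> B i \<noteq> {})}"

(* The count does not depend on the choice of the block system (card_insets below),
   so it is defined on one concrete system: X_i = {i} x {0,1} and Y = {0} x {0,...,m-1}. *)

definition std_block :: "nat \<Rightarrow> (nat \<times> nat) set" where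
  "std_block i = {i} \<times> {0, 1}"

definition std_rest :: "nat \<Rightarrow> (nat \<times> nat) set" where
  "std_rest m = {0} \<times> {..<m}"

definition std_set :: "nat \<Rightarrow> nat \<Rightarrow> (nat \<times> nat) set" where
  "std_set m n = (\<Union>i\<in>{1..n}. std_block i) \<union> std_rest m"

definition inset_number :: "nat \<Rightarrow> nat \<Rightarrow> nat \<Rightarrow> nat" where
  "inset_number m n k = card (insets n k (std_set m n) std_block)"

lemma block_system_std: "block_system m n (std_set m n) std_block (std_rest m)"
  unfolding block_system_def std_set_def std_block_def std_rest_def disjoint_family_on_def
  by (auto simp: card_cartesian_product)

lemma block_system_bij:
  assumes "block_system m n X B Y" "block_system m n X' B' Y'"
  shows "\<exists>f. bij_betw f X X' \<and> (\<forall>i\<in>{1..n}. f ` B i = B' i)"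
proof -
  note d = assms[unfolded block_system_def disjoint_family_on_def]
  have "\<exists>g. bij_betw g (B i) (B' i)" if "i \<in> {1..n}" for i
    by (rule finite_same_card_bij) (use that d in \<open>simp_all add: card_ge_0_finite\<close>)
  then obtain g where g: "\<And>i. i \<in> {1..n} \<Longrightarrow> bij_betw (g i) (B i) (B' i)"
    by metis
  obtain h where h: "bij_betw h Y Y'"
    using finite_same_card_bij[of Y Y'] d by auto
  define f where "f x = (if x \<in> Y then h x else g (SOME i. i \<in> {1..n} \<and> x \<in> B i) x)" for x
  have fB: "f x = g i x" if i: "i \<in> {1..n}" and x: "x \<in> B i" for i x
  proof -
    have "(SOME j. j \<in> {1..n} \<and> x \<in> B j) = i"
    proof (rule some_equality)
      fix j assume "j \<in> {1..n} \<and> x \<in> B j"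
      then show "j = i" using d(1) i x by blast
    qed (use i x in auto)
    moreover have "x \<notin> Y" using d(1) i x by blast
    ultimately show ?thesis by (simp add: f_def)
  qed
  have bB: "bij_betw f (B i) (B' i)" if "i \<in> {1..n}" for i
    using g[OF that] fB[OF that] by (simp cong: bij_betw_cong)
  have bY: "bij_betw f Y Y'"
    using h by (simp add: f_def cong: bij_betw_cong)
  have "bij_betw f (\<Union>i\<in>{1..n}. B i) (\<Union>i\<in>{1..n}. B' i)"
    by (rule bij_betw_UNION_disjoint) (use assms bB in \<open>auto simp: block_system_def\<close>)
  then have "bij_betw f X X'"
    using bij_betw_combine[OF _ bY, of "\<Union>i\<in>{1..n}. B i" "\<Union>i\<in>{1..n}. B' i"] d
    by (metis (no_types, lifting) UN_simps(4) SUP_bot_conv(2))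
  moreover have "\<forall>i\<in>{1..n}. f ` B i = B' i"
    using bB by (metis bij_betw_imp_surj_on)
  ultimately show ?thesis by blast
qed

lemma card_insets_le:
  assumes "block_system m n X B Y" "block_system m n X' B' Y'"
  shows "card (insets n k X B) \<le> card (insets n k X' B')"
proof -
  obtain f where f: "bij_betw f X X'" and fB: "\<And>i. i \<in> {1..n} \<Longrightarrow> f ` B i = B' i"
    using block_system_bij[OF assms] by blast
  have inj: "inj_on f X" using f by (rule bij_betw_imp_inj_on)
  have "finite X'"
    using assms(2) unfolding block_system_def by (simp add: card_ge_0_finite)
  then have fin: "finite (insets n k X' B')"
    by (auto simp: insets_def intro: finite_subset[of _ "Pow X'"])
  have sub: "(`) f ` insets n k X B \<subseteq> insets n k X' B'"
  proof
    fix T assume "T \<in> (`) f ` insets n k X B"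
    then obtain S where S: "S \<in> insets n k X B" "T = f ` S" by blast
    have "card T = n + k"
      using S inj by (auto simp: insets_def card_image inj_on_subset)
    moreover have "T \<subseteq> X'"
      using S f by (auto simp: insets_def bij_betw_def)
    moreover have "T \<inter> B' i \<noteq> {}" if "i \<in> {1..n}" for i
    proof -
      have "\<forall>i\<in>{1..n}. S \<inter> B i \<noteq> {}"
        using S(1) by (simp add: insets_def)
      then have "S \<inter> B i \<noteq> {}"
        using that by (rule bspec)
      then obtain x where "x \<in> S" "x \<in> B i"
        by blast
      then have "f x \<in> T" "f x \<in> B' i"
        using imageI[of x S f] imageI[of x "B i" f] unfolding S(2) fB[OF that] by simp_all
      then show ?thesis unfolding disjoint_iff by (metis)
    qed
    ultimately show "T \<in> insets n k X' B'"
      unfolding insets_def by blast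
  qed
  have "inj_on ((`) f) (insets n k X B)"
    by (rule inj_on_subset[OF inj_on_image_Pow[OF inj]]) (auto simp: insets_def)
  with sub fin show ?thesis by (meson card_inj_on_le)
qed

lemma card_insets:
  assumes "block_system m n X B Y"
  shows "card (insets n k X B) = inset_number m n k"
  unfolding inset_number_def
  using card_insets_le[OF assms block_system_std] card_insets_le[OF block_system_std assms]
  by (rule antisym)

end

theory Submission
  imports Defs
begin

text \<open>
  Write \<open>N m p k\<close> for \<open>inset_number m p k\<close>. The proof rests on one combinatorial fact,
  \<open>inset_number_Suc\<close>: breaking up a block \<open>{u, v}\<close> gives
  \<open>N m (p+1) k = N (m+1) p k + N m p k\<close>, because an inset that contains \<open>u\<close> is free to contain
  \<open>v\<close> or not, whereas an inset that avoids \<open>u\<close> is forced to contain \<open>v\<close>.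

  Read as \<open>N (m+1) p k = N m (p+1) k - N m p k\<close> with \<open>p = n + k - (m+1)\<close>, this says that raising
  \<open>m\<close> by one turns the sequence \<open>n \<mapsto> N m (n+k-m) k\<close> into its difference sequence, which on the
  side of power series is multiplication by \<open>1 - x\<close>. So everything reduces to \<open>m = 0\<close>.

  For \<open>m = 0\<close> let \<open>G k\<close> be the generating function of \<open>n \<mapsto> N 0 (n+k) k\<close>. By induction on the
  number of blocks the recurrence propagates Pascal's rule from binomial coefficients to all
  \<open>N\<close>. Together these give \<open>N 0 (p+1) (k+1) = 2 * N 0 p (k+1) + N 0 p k\<close>, that is,
  \<open>(1 - 2x) G (k+1) = G k\<close>; and \<open>(1 - 2x) G 0 = 1\<close> since \<open>N 0 n 0 = 2^n\<close>.
\<close>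

lemma inset_number_0: "inset_number m 0 k = m choose k"
proof -
  have "inset_number m 0 k = card {S. S \<subseteq> std_rest m \<and> card S = k}"
    by (simp add: inset_number_def insets_def std_set_def)
  also have "\<dots> = m choose k"
    by (subst n_subsets) (simp_all add: std_rest_def card_cartesian_product)
  finally show ?thesis .
qed

text \<open>
  The two parts are the insets that contain \<open>u\<close> and those that do not. For the former, \<open>v\<close>
  becomes one more point outside the remaining blocks; the latter must contain \<open>v\<close>. In both
  cases one point and one block are removed, so the excess \<open>k\<close> of size over number of blocks stays the same.
\<close>

lemma insets_split_block:
  assumes bs: "block_system m (Suc p) X B Y"
    and uv: "B (Suc p) = {u, v}" "u \<noteq> v"
  shows "insets (Suc p) k X B =
           insert u ` insets p k (X - {u}) B \<union> insert v ` insets p k (X - {u, v}) B"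
    (is "?I = ?U \<union> ?V")
proof (intro equalityI subsetI)
  note d = bs[unfolded block_system_def disjoint_family_on_def]
  have fin: "finite X" using d by (simp add: card_ge_0_finite)
  have uvX: "u \<in> X" "v \<in> X" using d uv by auto
  have uvB: "u \<notin> B i" "v \<notin> B i" if "i \<in> {1..p}" for i
  proof -
    have "B i \<inter> B (Suc p) = {}" using d that by auto
    then show "u \<notin> B i" "v \<notin> B i" using uv by auto
  qed
  have ran: "{1..Suc p} = insert (Suc p) {1..p}" by auto
  have I: "?I = {S. S \<subseteq> X \<and> card S = Suc p + k \<and> S \<inter> {u, v} \<noteq> {} \<and> (\<forall>i\<in>{1..p}. S \<inter> B i \<noteq> {})}"
    by (simp only: insets_def ran ball_simps uv)
  {
    fix S assume "S \<in> ?I"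
    then have S: "S \<subseteq> X" "card S = Suc p + k" "\<forall>i\<in>{1..p}. S \<inter> B i \<noteq> {}" "S \<inter> {u, v} \<noteq> {}"
      unfolding I by blast+
    have "finite S" using S fin finite_subset by blast
    show "S \<in> ?U \<union> ?V"
    proof (cases "u \<in> S")
      case True
      then have "S - {u} \<in> insets p k (X - {u}) B"
        using S uvB \<open>finite S\<close> by (fastforce simp: insets_def)
      with True have "S \<in> ?U" by (metis image_eqI insert_Diff)
      then show ?thesis by blast
    next
      case False
      then have "v \<in> S" using S by auto
      then have "S - {v} \<in> insets p k (X - {u, v}) B"
        using False S uvB \<open>finite S\<close> by (fastforce simp: insets_def)
      with \<open>v \<in> S\<close> have "S \<in> ?V" by (metis image_eqI insert_Diff)
      then show ?thesis by blast
    qed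
  next
    have meets: "insert w T \<in> ?I"
      if "w \<in> {u, v}" "w \<notin> Z" "Z \<subseteq> X" "T \<in> insets p k Z B" for w T Z
    proof -
      have T: "T \<subseteq> Z" "card T = p + k" "\<forall>i\<in>{1..p}. T \<inter> B i \<noteq> {}"
        using that(4) by (auto simp: insets_def)
      then have "w \<notin> T" "T \<subseteq> X" using that(2,3) by blast+
      moreover from this have "finite T" using fin by (simp add: finite_subset)
      ultimately show ?thesis
        unfolding I using T that(1) uvX by (simp add: card_insert_disjoint) blast
    qed
    fix S assume "S \<in> ?U \<union> ?V"
    then show "S \<in> ?I"
      using meets[of u "X - {u}"] meets[of v "X - {u, v}"] by blast
  }
qed

lemma inset_number_Suc:
  "inset_number m (Suc p) k = inset_number (Suc m) p k + inset_number m p k"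
proof -
  let ?X = "std_set m (Suc p)" and ?B = std_block and ?Y = "std_rest m"
  let ?u = "(Suc p, 0) :: nat \<times> nat" and ?v = "(Suc p, 1) :: nat \<times> nat"
  let ?U = "insets p k (?X - {?u}) ?B" and ?V = "insets p k (?X - {?u, ?v}) ?B"
  have blk: "?B (Suc p) = {?u, ?v}" by (auto simp: std_block_def)
  have std: "block_system m p (std_set m p) ?B ?Y" by (rule block_system_std)
  have V: "?X - {?u, ?v} = std_set m p"
    by (auto simp: std_set_def std_block_def std_rest_def atLeastAtMostSuc_conv)
  have "?X - {?u} = (\<Union>i\<in>{1..p}. ?B i) \<union> insert ?v ?Y"
    by (auto simp: std_set_def std_block_def std_rest_def atLeastAtMostSuc_conv)
  moreover have "?v \<notin> ?Y" "\<forall>i\<in>{1..p}. ?v \<notin> ?B i"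
    by (auto simp: std_block_def std_rest_def)
  ultimately have "block_system (Suc m) p (?X - {?u}) ?B (insert ?v ?Y)"
    using std by (simp add: block_system_def)
  then have U: "card ?U = inset_number (Suc m) p k" by (rule card_insets)
  have fin: "finite ?U" "finite ?V"
    by (rule finite_subset[of _ "Pow ?X"];
        force simp: insets_def std_set_def std_block_def std_rest_def)+
  have disj: "insert ?u ` ?U \<inter> insert ?v ` ?V = {}" by (auto simp: insets_def)
  have inj: "inj_on (insert ?u) ?U" "inj_on (insert ?v) ?V"
    by (intro inj_onI; auto simp: insets_def dest!: insert_ident[THEN iffD1, rotated 2])+
  have "inset_number m (Suc p) k = card (insert ?u ` ?U \<union> insert ?v ` ?V)"
    unfolding inset_number_def
    by (subst insets_split_block[OF block_system_std blk]) simp_all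
  also have "\<dots> = card ?U + card ?V"
    using fin disj inj by (simp add: card_Un_disjoint card_image)
  finally show ?thesis using U V by (simp add: inset_number_def)
qed

lemma inset_number_Pascal:
  "inset_number (Suc m) p (Suc k) = inset_number m p (Suc k) + inset_number m p k"
  by (induction p arbitrary: m) (simp_all add: inset_number_0 inset_number_Suc)

lemma inset_number_excess_0: "inset_number m p 0 = 2 ^ p"
  by (induction p arbitrary: m) (simp_all add: inset_number_0 inset_number_Suc)

lemma inset_number_eq_0: "p + m < k \<Longrightarrow> inset_number m p k = 0"
  by (induction p arbitrary: m) (simp_all add: inset_number_0 inset_number_Suc)

definition inset_fps :: "nat \<Rightarrow> 'a :: field_char_0 fps" where
  "inset_fps k = Abs_fps (\<lambda>n. of_nat (inset_number 0 (n + k) k))"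

lemma fps_nth_one_minus_const_X_mult:
  fixes c :: "'a :: field_char_0"
  shows "fps_nth ((1 - fps_const c * fps_X) * F) n =
           fps_nth F n - (if n = 0 then 0 else c * fps_nth F (n - 1))"
  by (simp add: left_diff_distrib mult.assoc)

lemma inset_fps_0: "(1 - 2 * fps_X) * inset_fps 0 = 1"
  unfolding numeral_fps_const
proof (rule fps_ext)
  fix n show "fps_nth ((1 - fps_const 2 * fps_X) * inset_fps 0 :: 'a fps) n = fps_nth 1 n"
    unfolding fps_nth_one_minus_const_X_mult
    by (cases n) (simp_all add: inset_fps_def inset_number_excess_0)
qed

text \<open>
  The constant term needs the vanishing of \<open>inset_number 0 k (k+1)\<close>: only \<open>2k\<close> points are available
  for a set of size \<open>2k + 1\<close>.
\<close>

lemma inset_fps_Suc: "(1 - 2 * fps_X) * inset_fps (Suc k) = inset_fps k"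
  unfolding numeral_fps_const
proof (rule fps_ext)
  fix n
  have "inset_number 0 (Suc p) (Suc k) = 2 * inset_number 0 p (Suc k) + inset_number 0 p k" for p
    by (simp add: inset_number_Suc inset_number_Pascal)
  then show "fps_nth ((1 - fps_const 2 * fps_X) * inset_fps (Suc k) :: 'a fps) n =
      fps_nth (inset_fps k) n"
    unfolding fps_nth_one_minus_const_X_mult
    by (cases n) (simp_all add: inset_fps_def inset_number_eq_0)
qed

lemma inset_fps_closed_form:
  "(1 - 2 * fps_X) ^ (k + 1) * inset_fps k = (1 :: 'a :: field_char_0 fps)"
proof (induction k)
  case 0
  show ?case by (simp add: inset_fps_0)
next
  case (Suc k)
  have "(1 - 2 * fps_X) ^ (Suc k + 1) * inset_fps (Suc k) =
      (1 - 2 * fps_X) ^ (k + 1) * ((1 - 2 * fps_X) * inset_fps (Suc k) :: 'a fps)"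
    by (simp only: add_Suc power_Suc2 mult.assoc)
  then show ?case using Suc.IH by (simp only: inset_fps_Suc)
qed

lemma fps_nth_inset_fps:
  assumes "n + k \<ge> m"
  shows "fps_nth ((1 - fps_X) ^ m * inset_fps k) n = of_nat (inset_number m (n + k - m) k)"
  using assms
proof (induction m arbitrary: n)
  case 0
  show ?case by (simp add: inset_fps_def)
next
  case (Suc m)
  let ?F = "(1 - fps_X) ^ m * inset_fps k :: 'a fps"
  define p where "p = n + k - Suc m"
  have p: "n + k - m = Suc p" using Suc.prems by (simp add: p_def)
  have "fps_nth ((1 - fps_X) ^ Suc m * inset_fps k :: 'a fps) n =
      fps_nth ?F n - (if n = 0 then 0 else fps_nth ?F (n - 1))"
    using fps_nth_one_minus_const_X_mult[of 1 ?F n] by (simp add: mult.assoc)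
  also have "fps_nth ?F n = of_nat (inset_number m (Suc p) k)"
    using Suc.IH[of n] Suc.prems p by simp
  also have "(if n = 0 then 0 else fps_nth ?F (n - 1)) = of_nat (inset_number m p k)"
  proof (cases n)
    case 0
    \<comment> \<open>The recurrence still has the term for \<open>n - 1\<close>; it is zero, as \<open>p + m = k - 1\<close> here.\<close>
    then show ?thesis using Suc.prems by (simp add: inset_number_eq_0 p_def)
  next
    case (Suc n')
    then show ?thesis using Suc.IH[of n'] Suc.prems by (simp add: p_def)
  qed
  also have "of_nat (inset_number m (Suc p) k) - of_nat (inset_number m p k) =
      (of_nat (inset_number (Suc m) p k) :: 'a)"
    by (simp add: inset_number_Suc)
  finally show ?case by (simp only: p_def)
qed

theorem proposition10:
  fixes m k n :: nat
  assumes "n + k \<ge> m"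
  shows "fps_nth ((1 - fps_X) ^ m / (1 - 2 * fps_X) ^ (k + 1) :: 'a :: field_char_0 fps) n
           = of_nat (inset_number m (n + k - m) k)"
proof -
  let ?D = "(1 - 2 * fps_X) ^ (k + 1) :: 'a fps"
  have D: "?D * inset_fps k = 1" by (rule inset_fps_closed_form)
  then have "?D \<noteq> 0" by auto
  have "(1 - fps_X) ^ m / ?D = (?D * ((1 - fps_X) ^ m * inset_fps k)) / ?D"
    using D by (simp only: mult.left_commute[of ?D] mult_1_right)
  also have "\<dots> = (1 - fps_X) ^ m * inset_fps k"
    using \<open>?D \<noteq> 0\<close> by (rule nonzero_mult_div_cancel_left)
  finally show ?thesis using fps_nth_inset_fps[OF assms] by simp
qed

end
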